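(* Let $x^0\in\mathbb{R}^p$ and consider the stochastic Gauss-Newton method $$d^k\in\operatorname*{argmin}_{d\in\mathbb{R}^p}\big\|DF(x^k)^\top d+\gamma F(x^k)\big\|^2_{\mathbf{H}_{\mathbf{S}_k}(x^k)},\qquad x^{k+1}=x^k+d^k,$$ where $\mathbf{S}_k$ is sampled from $\mathcal{D}_{x^k}$ at the $k$th iteration and $d^k$ is the least-norm solution of the minimization problem. If $F(x)\in\mathrm{Im}(DF(x)^\top)$ for all $x\in\mathbb{R}^p$, then these iterates are equal to the iterates of the Sketched Newton-Raphson method $$x^{k+1}=x^k-\gamma\,DF(x^k)\mathbf{S}_k\big(\mathbf{S}_k^\top DF(x^k)^\top DF(x^k)\mathbf{S}_k\big)^\dagger\mathbf{S}_k^\top F(x^k).$$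
   Context: $F:\mathbb{R}^p\to\mathbb{R}^m$ is continuously differentiable, $DF(x)=[\nabla F_1(x)\ \cdots\ \nabla F_m(x)]\in\mathbb{R}^{p\times m}$ is the transpose of its Jacobian, and $\gamma>0$ is the stepsize. For each $x$, $\mathcal{D}_x$ is a probability distribution over sketching matrices $\mathbf{S}\in\mathbb{R}^{m\times\tau}$; both methods use the same $x^0$ and the same sampled matrices $\mathbf{S}_k$. $\dagger$ is the Moore-Penrose pseudoinverse, $\mathbf{H}_{\mathbf{S}}(x)=\mathbf{S}\big(\mathbf{S}^\top DF(x)^\top DF(x)\mathbf{S}\big)^\dagger\mathbf{S}^\top$, and $\|v\|_{\mathbf{M}}=\sqrt{v^\top\mathbf{M}v}$ for symmetric positive semidefinite $\mathbf{M}$. $\mathrm{Im}$ is the image (column space); "least-norm" refers to the Euclidean norm. *)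

theory Defs
  imports "HOL-Analysis.Analysis" "HOL-Probability.Probability"
begin

(* An m x n real matrix has type real^'n^'m. *)

(* The four Penrose equations; they determine B uniquely, and a solution exists for every A. *)
definition is_pinv :: "real^'n^'m \<Rightarrow> real^'m^'n \<Rightarrow> bool" where
  "is_pinv A B \<longleftrightarrow>
     A ** B ** A = A \<and>
     B ** A ** B = B \<and>
     transpose (A ** B) = A ** B \<and>
     transpose (B ** A) = B ** A"

definition pinv :: "real^'n^'m \<Rightarrow> real^'m^'n" where
  "pinv A = (THE B. is_pinv A B)"

definition continuously_differentiable :: "(real^'p \<Rightarrow> real^'m) \<Rightarrow> bool" where
  "continuously_differentiable F \<longleftrightarrow>
     (\<forall>x. F differentiable (at x)) \<and> continuous_on UNIV (\<lambda>x. jacobian F (at x))"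

(* The transposed Jacobian: its columns are the gradients of the components of F. *)
definition DF :: "(real^'p \<Rightarrow> real^'m) \<Rightarrow> real^'p \<Rightarrow> real^'m^'p" where
  "DF F x = transpose (jacobian F (at x))"

definition sketch_H :: "(real^'p \<Rightarrow> real^'m) \<Rightarrow> real^'t^'m \<Rightarrow> real^'p \<Rightarrow> real^'m^'m" where
  "sketch_H F S x =
     S ** pinv (transpose S ** transpose (DF F x) ** DF F x ** S) ** transpose S"

(* Intended for symmetric positive semidefinite M only. *)
definition wnorm :: "real^'n^'n \<Rightarrow> real^'n \<Rightarrow> real" where
  "wnorm M v = sqrt (v \<bullet> (M *v v))"

definition gn_objective ::
  "(real^'p \<Rightarrow> real^'m) \<Rightarrow> real \<Rightarrow> real^'t^'m \<Rightarrow> real^'p \<Rightarrow> real^'p \<Rightarrow> real" where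
  "gn_objective F \<gamma> S x d =
     (wnorm (sketch_H F S x) (transpose (DF F x) *v d + \<gamma> *\<^sub>R F x))\<^sup>2"

(* Least Euclidean norm among the global minimizers of the objective. *)
definition is_least_norm_argmin :: "('a::real_normed_vector \<Rightarrow> real) \<Rightarrow> 'a \<Rightarrow> bool" where
  "is_least_norm_argmin f d \<longleftrightarrow> is_arg_min norm (is_arg_min f (\<lambda>_. True)) d"

definition gn_step ::
  "(real^'p \<Rightarrow> real^'m) \<Rightarrow> real \<Rightarrow> real^'t^'m \<Rightarrow> real^'p \<Rightarrow> real^'p" where
  "gn_step F \<gamma> S x = (THE d. is_least_norm_argmin (gn_objective F \<gamma> S x) d)"

(* In both recursions S is one realization S 0, S 1, ... of the sketching matrices. *)
primrec gn_iterates ::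
  "(real^'p \<Rightarrow> real^'m) \<Rightarrow> real \<Rightarrow> real^'p \<Rightarrow> (nat \<Rightarrow> real^'t^'m) \<Rightarrow> nat \<Rightarrow> real^'p" where
  "gn_iterates F \<gamma> x0 S 0 = x0"
| "gn_iterates F \<gamma> x0 S (Suc k) =
     gn_iterates F \<gamma> x0 S k + gn_step F \<gamma> (S k) (gn_iterates F \<gamma> x0 S k)"

definition snr_update ::
  "(real^'p \<Rightarrow> real^'m) \<Rightarrow> real \<Rightarrow> real^'t^'m \<Rightarrow> real^'p \<Rightarrow> real^'p" where
  "snr_update F \<gamma> S x =
     x - \<gamma> *\<^sub>R ((DF F x ** S ** pinv (transpose S ** transpose (DF F x) ** DF F x ** S)
                 ** transpose S) *v F x)"

primrec snr_iterates ::
  "(real^'p \<Rightarrow> real^'m) \<Rightarrow> real \<Rightarrow> real^'p \<Rightarrow> (nat \<Rightarrow> real^'t^'m) \<Rightarrow> nat \<Rightarrow> real^'p" where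
  "snr_iterates F \<gamma> x0 S 0 = x0"
| "snr_iterates F \<gamma> x0 S (Suc k) = snr_update F \<gamma> (S k) (snr_iterates F \<gamma> x0 S k)"

(* The sigma-algebra generated by S 0, ..., S (k - 1). *)
definition past :: "'w measure \<Rightarrow> (nat \<Rightarrow> 'w \<Rightarrow> 'b::topological_space) \<Rightarrow> nat \<Rightarrow> 'w measure" where
  "past M S k = sigma (space M) (\<Union>i\<in>{..<k}. {S i -` A \<inter> space M | A. A \<in> sets borel})"

(* S k is drawn from D (X k): given the earlier draws, D (X k) is the conditional law of S k. *)
definition sampled_from ::
  "'w measure \<Rightarrow> ('a \<Rightarrow> 'b::topological_space measure) \<Rightarrow> (nat \<Rightarrow> 'w \<Rightarrow> 'a)
     \<Rightarrow> (nat \<Rightarrow> 'w \<Rightarrow> 'b) \<Rightarrow> bool" where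
  "sampled_from M D X S \<longleftrightarrow>
     (\<forall>k. S k \<in> borel_measurable M) \<and>
     (\<forall>k. \<forall>A \<in> sets borel. AE \<omega> in M.
        real_cond_exp M (past M S k) (indicator (S k -` A)) \<omega> = measure (D (X k \<omega>)) A)"

end

theory Submission
  imports Defs
begin

text \<open>
  Write \<open>A = DF F x\<close>, \<open>B = A S\<close> and \<open>P = B (B\<^sup>T B)\<^sup>\<dagger> B\<^sup>T\<close>. The Penrose equations make \<open>P\<close> symmetric and
  idempotent, so \<open>P\<close> is an orthogonal projection. If \<open>F x = A\<^sup>T w\<close>, the Gauss-Newton objective at \<open>d\<close> is
  \<open>\<parallel>P (d + \<gamma> w)\<parallel>\<^sup>2\<close>; its minimizers are the solutions of \<open>P d = - \<gamma> P w\<close>, and the shortest of them is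
  \<open>- \<gamma> P w = - \<gamma> A S (B\<^sup>T B)\<^sup>\<dagger> S\<^sup>T F x\<close>, the Newton-Raphson step.
\<close>

section \<open>Existence, uniqueness and symmetry of the pseudoinverse\<close>

text \<open>The products \<open>A ** B\<close> and \<open>A ** C\<close> are symmetric and each
  absorbs the other, so transposing \<open>A ** B = (A ** C) ** (A ** B)\<close> reverses the
  factors and leaves \<open>A ** C\<close>. The same works for \<open>B ** A\<close> and
  \<open>C ** A\<close>, and then \<open>B = B ** A ** B = C ** A ** C = C\<close>.\<close>

lemma is_pinv_unique:
  fixes A :: "real^'n^'m"
  assumes B: "is_pinv A B" and C: "is_pinv A C"
  shows "B = C"
proof -
  have "A ** B = transpose (A ** B)"
    using B by (simp add: is_pinv_def)
  also have "\<dots> = transpose ((A ** C) ** (A ** B))"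
    using C by (simp add: is_pinv_def matrix_mul_assoc)
  also have "\<dots> = (A ** B) ** (A ** C)"
    using B C by (simp add: is_pinv_def matrix_transpose_mul[of "A ** C"])
  also have "\<dots> = A ** C"
    using B by (simp add: is_pinv_def matrix_mul_assoc)
  finally have l: "A ** B = A ** C" .
  have "B ** A = transpose (B ** A)"
    using B by (simp add: is_pinv_def)
  also have "\<dots> = transpose ((B ** A) ** (C ** A))"
    using C by (simp add: is_pinv_def flip: matrix_mul_assoc)
  also have "\<dots> = (C ** A) ** (B ** A)"
    using B C by (simp add: is_pinv_def matrix_transpose_mul[of "B ** A"])
  also have "\<dots> = C ** A"
    using B by (simp add: is_pinv_def flip: matrix_mul_assoc)
  finally have r: "B ** A = C ** A" .
  have "B = B ** A ** B"
    using B by (simp add: is_pinv_def)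
  also have "\<dots> = C ** A ** C"
    by (metis l r matrix_mul_assoc)
  also have "\<dots> = C"
    using C by (simp add: is_pinv_def)
  finally show ?thesis .
qed

lemma generalized_inverse_exists:
  fixes A :: "real^'n^'m"
  obtains L :: "real^'m^'n" where "A ** L ** A = A"
proof -
  obtain g where g: "linear g" "\<forall>v\<in>range ((*v) A). A *v g v = v"
    using linear_exists_right_inverse_on[of "(*v) A" UNIV] by auto
  have "(A ** matrix g ** A) *v x = A *v x" for x
    using g by (simp add: matrix_works flip: matrix_vector_mul_assoc)
  then show ?thesis
    using that[of "matrix g"] by (simp add: matrix_eq)
qed

text \<open>Any generalized inverse \<open>Z\<close> of the Gram matrix of \<open>A\<close> turns
  \<open>A ** Z ** transpose A\<close> into the orthogonal projection onto the range of
  \<open>A\<close>, because the Gram matrix and \<open>A\<close> have the same kernel.\<close>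

lemma range_projection_exists:
  fixes A :: "real^'n^'m"
  obtains Z :: "real^'n^'n" where
    "A ** Z ** transpose A ** A = A"
    "transpose (A ** Z ** transpose A) = A ** Z ** transpose A"
proof -
  let ?G = "transpose A ** A"
  obtain Z where Z: "?G ** Z ** ?G = ?G"
    using generalized_inverse_exists .
  have fix_A: "A ** Z ** transpose A ** A = A"
  proof -
    have "A *v (Z *v (?G *v x)) = A *v x" for x
    proof -
      define y where "y = Z *v (?G *v x) - x"
      have "?G *v y = 0"
        using arg_cong[OF Z, of "\<lambda>M. M *v x"]
        by (simp add: y_def matrix_vector_mult_diff_distrib flip: matrix_vector_mul_assoc)
      have "(A *v y) \<bullet> (A *v y) = (transpose A *v (A *v y)) \<bullet> y"
        by (simp add: dot_lmul_matrix)
      also have "\<dots> = 0"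
        using \<open>?G *v y = 0\<close> by (simp only: matrix_vector_mul_assoc inner_zero_left)
      finally have "A *v y = 0"
        by (simp only: inner_eq_zero_iff)
      then show ?thesis
        by (simp add: y_def matrix_vector_mult_diff_distrib)
    qed
    then show ?thesis
      by (simp add: matrix_eq flip: matrix_vector_mul_assoc)
  qed
  let ?P = "A ** Z ** transpose A"
  have "?P ** transpose ?P = (?P ** A) ** transpose Z ** transpose A"
    by (simp add: matrix_transpose_mul matrix_mul_assoc)
  also have "\<dots> = transpose ?P"
    by (subst fix_A) (simp add: matrix_transpose_mul matrix_mul_assoc)
  \<comment> \<open>The left-hand side equals its own transpose, hence so does the right-hand
    side.\<close>
  finally have "?P ** transpose ?P = transpose ?P" .
  then have "transpose ?P = ?P"
    by (metis matrix_transpose_mul transpose_transpose)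
  then show ?thesis
    using that fix_A by blast
qed

text \<open>With \<open>P\<close> and \<open>R\<close> the orthogonal projections onto the column
  and row space of \<open>A\<close> and \<open>L\<close> any generalized inverse, the witness is
  \<open>R ** L ** P\<close>: its products with \<open>A\<close> collapse to \<open>P\<close> and
  \<open>R\<close>, which are symmetric.\<close>

lemma is_pinv_exists:
  fixes A :: "real^'n^'m"
  obtains B where "is_pinv A B"
proof -
  obtain Z where Z: "A ** Z ** transpose A ** A = A"
    "transpose (A ** Z ** transpose A) = A ** Z ** transpose A"
    using range_projection_exists .
  define P where "P = A ** Z ** transpose A"
  obtain W where W: "transpose A ** W ** A ** transpose A = transpose A"
    "transpose (transpose A ** W ** A) = transpose A ** W ** A"
    using range_projection_exists[of "transpose A"] by auto
  define R where "R = transpose A ** W ** A"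
  obtain L where L: "A ** L ** A = A"
    using generalized_inverse_exists .
  have PA: "P ** A = A"
    using Z by (simp add: P_def)
  \<comment> \<open>This is the transpose of \<open>R ** transpose A = transpose A\<close>, since
    \<open>R\<close> is symmetric.\<close>
  have AR: "A ** R = A"
  proof -
    have "A ** R = transpose (R ** transpose A)"
      using W(2) by (simp add: R_def matrix_transpose_mul[of _ "transpose A"])
    also have "\<dots> = A"
      using W(1) by (simp add: R_def)
    finally show ?thesis .
  qed
  \<comment> \<open>\<open>P\<close> has \<open>A\<close> as its left factor, and
    \<open>A ** L\<close> fixes \<open>A\<close>.\<close>
  have ALP: "A ** L ** P = P"
    by (simp add: P_def matrix_mul_assoc L)
  have RLA: "R ** L ** A = R"
  proof -
    have "R ** L ** A = transpose A ** W ** (A ** L ** A)"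
      by (simp add: R_def matrix_mul_assoc)
    then show ?thesis by (simp add: L R_def)
  qed
  have RR: "R ** R = R"
  proof -
    have "R ** R = transpose A ** W ** (A ** R)"
      by (simp add: R_def matrix_mul_assoc)
    then show ?thesis unfolding AR by (simp add: R_def)
  qed
  have AB: "A ** (R ** L ** P) = P"
    by (simp add: matrix_mul_assoc AR ALP)
  have BA: "R ** L ** P ** A = R"
    by (simp add: PA RLA flip: matrix_mul_assoc) (simp add: RLA matrix_mul_assoc)
  have RB: "R ** (R ** L ** P) = R ** L ** P"
    by (simp add: matrix_mul_assoc RR)
  have "is_pinv A (R ** L ** P)"
    unfolding is_pinv_def AB BA
    using PA RB Z(2) W(2) by (simp only: P_def R_def simp_thms)
  then show ?thesis
    using that by blast
qed

lemma is_pinv_pinv: "is_pinv A (pinv A)"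
  unfolding pinv_def by (rule theI') (metis is_pinv_exists is_pinv_unique)

lemma is_pinv_transpose:
  assumes "is_pinv A B"
  shows "is_pinv (transpose A) (transpose B)"
proof -
  have "transpose A ** transpose B ** transpose A = transpose (A ** B ** A)"
    and "transpose B ** transpose A ** transpose B = transpose (B ** A ** B)"
    and "transpose A ** transpose B = transpose (B ** A)"
    and "transpose B ** transpose A = transpose (A ** B)"
    by (simp_all add: matrix_transpose_mul matrix_mul_assoc)
  then show ?thesis
    using assms unfolding is_pinv_def by (simp only: simp_thms)
qed

text \<open>For a Gram matrix this says that the pseudoinverse is symmetric.\<close>

lemma transpose_pinv: "transpose (pinv A) = pinv (transpose A)"
  by (rule is_pinv_unique[OF is_pinv_transpose[OF is_pinv_pinv] is_pinv_pinv])

section \<open>Orthogonal projections and least-norm minimizers\<close>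

text \<open>Symmetry is inherited from the Gram matrix; idempotence is the second Penrose equation
  for its pseudoinverse.\<close>

lemma range_projection_pinv:
  fixes B :: "real^'n^'m"
  defines "P \<equiv> B ** pinv (transpose B ** B) ** transpose B"
  shows "transpose P = P" and "P ** P = P"
proof -
  show "transpose P = P"
    by (simp add: P_def matrix_transpose_mul transpose_pinv matrix_mul_assoc)
  have "P ** P = B ** (pinv (transpose B ** B) ** (transpose B ** B) ** pinv (transpose B ** B))
      ** transpose B"
    by (simp add: P_def matrix_mul_assoc)
  then show "P ** P = P"
    using is_pinv_pinv[of "transpose B ** B"] by (simp add: is_pinv_def P_def)
qed

lemma inner_orthogonal_projection:
  fixes P :: "real^'n^'n"
  assumes "transpose P = P" "P ** P = P"
  shows "x \<bullet> (P *v y) = (P *v x) \<bullet> (P *v y)"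
proof -
  have "x \<bullet> (P *v y) = x \<bullet> (P *v (P *v y))"
    by (simp only: matrix_vector_mul_assoc assms)
  also have "\<dots> = (transpose P *v x) \<bullet> (P *v y)"
    by (simp only: transpose_matrix_vector dot_lmul_matrix)
  finally show ?thesis
    by (simp only: assms)
qed

text \<open>The value 0 is attained, so the minimizers are the zeros of \<open>f\<close>, that is,
  the \<open>d\<close> with \<open>P *v d = - (P *v u)\<close>. All of them share the component
  \<open>P *v d\<close>, and by Pythagoras the norm is least exactly when the rest of
  \<open>d\<close> vanishes.\<close>

lemma least_norm_argmin_projection:
  fixes P :: "real^'n^'n"
  assumes P: "transpose P = P" "P ** P = P"
    and f: "\<And>d. f d = (norm (P *v (d + u)))\<^sup>2"
  shows "is_least_norm_argmin f d \<longleftrightarrow> d = - (P *v u)"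
proof -
  have PP: "P *v (P *v x) = P *v x" for x
    by (simp add: matrix_vector_mul_assoc P)
  have P_neg: "P *v (- x) = - (P *v x)" for x
    using matrix_vector_mult_diff_distrib[of P 0 x] by simp
  have f0: "f (- (P *v u)) = 0"
    by (simp add: f matrix_vector_mult_diff_distrib PP)
  have f_nonneg: "0 \<le> f d" for d
    by (simp add: f)
  have min_iff: "is_arg_min f (\<lambda>_. True) d \<longleftrightarrow> P *v d = - (P *v u)" for d
  proof -
    have "is_arg_min f (\<lambda>_. True) d \<longleftrightarrow> f d = 0"
    proof
      assume "is_arg_min f (\<lambda>_. True) d"
      then have "f d \<le> f (- (P *v u))"
        by (simp only: is_arg_min_linorder simp_thms)
      then show "f d = 0"
        using f0 f_nonneg[of d] by linarith
    next
      assume "f d = 0"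
      then show "is_arg_min f (\<lambda>_. True) d"
        using f_nonneg by (simp only: is_arg_min_linorder simp_thms)
    qed
    also have "\<dots> \<longleftrightarrow> P *v d = - (P *v u)"
      by (simp add: f matrix_vector_right_distrib eq_neg_iff_add_eq_0)
    finally show ?thesis .
  qed
  have pythagoras: "(norm d)\<^sup>2 = (norm (P *v d))\<^sup>2 + (norm (d - P *v d))\<^sup>2" for d
    using inner_orthogonal_projection[OF P, of d d]
    by (simp add: power2_norm_eq_inner inner_diff_left inner_diff_right inner_commute)
  have norm_le: "norm (P *v d) \<le> norm d" for d
    by (rule power2_le_imp_le) (simp_all add: pythagoras[of d])
  have norm_eq: "P *v d = d" if "norm d \<le> norm (P *v d)" for d
  proof -
    have "(norm d)\<^sup>2 \<le> (norm (P *v d))\<^sup>2"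
      using that by (rule power_mono) simp
    then have "(norm (d - P *v d))\<^sup>2 \<le> 0"
      using pythagoras[of d] by linarith
    then show ?thesis by simp
  qed
  have sol: "P *v (- (P *v u)) = - (P *v u)"
    by (simp add: P_neg PP)
  show ?thesis
    unfolding is_least_norm_argmin_def is_arg_min_linorder[of norm] min_iff
    using norm_le norm_eq sol by metis
qed

section \<open>The Gauss-Newton step and the iterates\<close>

lemma gn_step_eq:
  fixes F :: "real^'p \<Rightarrow> real^'m" and S :: "real^'t^'m"
  assumes "F x \<in> range (\<lambda>v. transpose (DF F x) *v v)"
  shows "gn_step F \<gamma> S x =
    - (\<gamma> *\<^sub>R ((DF F x ** S ** pinv (transpose S ** transpose (DF F x) ** DF F x ** S)
               ** transpose S) *v F x))"
proof -
  obtain w where w: "F x = transpose (DF F x) *v w"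
    using assms by auto
  define A where "A = DF F x"
  define B where "B = A ** S"
  define P where "P = B ** pinv (transpose B ** B) ** transpose B"
  note P = range_projection_pinv[of B, folded P_def]
  have gram: "transpose S ** transpose A ** A ** S = transpose B ** B"
    by (simp add: B_def matrix_transpose_mul matrix_mul_assoc)
  \<comment> \<open>This identity turns the seminorm weighted by \<open>sketch_H\<close> on the
    residual into a Euclidean norm after projection.\<close>
  have P_eq: "P = A ** sketch_H F S x ** transpose A"
    unfolding sketch_H_def A_def[symmetric] gram
    by (simp add: P_def B_def matrix_transpose_mul matrix_mul_assoc)
  have "gn_objective F \<gamma> S x d = (norm (P *v (d + \<gamma> *\<^sub>R w)))\<^sup>2" for d
  proof -
    let ?z = "d + \<gamma> *\<^sub>R w"
    have res: "transpose A *v d + \<gamma> *\<^sub>R F x = transpose A *v ?z"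
      by (simp add: w A_def matrix_vector_right_distrib matrix_vector_mult_scaleR)
    have "(transpose A *v ?z) \<bullet> (sketch_H F S x *v (transpose A *v ?z)) = ?z \<bullet> (P *v ?z)"
      by (simp only: P_eq transpose_matrix_vector dot_lmul_matrix flip: matrix_vector_mul_assoc)
    also have "\<dots> = (norm (P *v ?z))\<^sup>2"
      unfolding power2_norm_eq_inner by (rule inner_orthogonal_projection[OF P])
    \<comment> \<open>The quadratic form is a squared norm, hence nonnegative, so squaring the
      \<open>sqrt\<close> in \<open>wnorm\<close> gives it back.\<close>
    finally show ?thesis
      unfolding gn_objective_def wnorm_def A_def[symmetric] res by simp
  qed
  \<comment> \<open>The equivalence singles out one vector, which is therefore the value of the
    definite description in \<open>gn_step\<close>.\<close>
  from least_norm_argmin_projection[OF P this]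
  have "gn_step F \<gamma> S x = - (P *v (\<gamma> *\<^sub>R w))"
    by (simp add: gn_step_def)
  \<comment> \<open>The arbitrary preimage \<open>w\<close> disappears: the last factor
    \<open>transpose A\<close> of \<open>P\<close> maps it back to \<open>F x\<close>.\<close>
  also have "P *v (\<gamma> *\<^sub>R w) = \<gamma> *\<^sub>R ((A ** sketch_H F S x) *v F x)"
    by (simp add: P_eq w A_def matrix_vector_mult_scaleR flip: matrix_vector_mul_assoc)
  finally show ?thesis
    by (simp add: sketch_H_def A_def matrix_mul_assoc)
qed

theorem lemmaA1:
  fixes F :: "real^'p \<Rightarrow> real^'m"
    and \<gamma> :: real
    and x0 :: "real^'p"
    and D :: "real^'p \<Rightarrow> (real^'t^'m) measure"
    and M :: "'w measure"
    and S :: "nat \<Rightarrow> 'w \<Rightarrow> real^'t^'m"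
  assumes "continuously_differentiable F"
    and "\<gamma> > 0"
    and "\<And>x. prob_space (D x)"
    and "\<And>x. sets (D x) = sets borel"
    and "prob_space M"
    and "sampled_from M D (\<lambda>k \<omega>. gn_iterates F \<gamma> x0 (\<lambda>i. S i \<omega>) k) S"
    and "\<And>x. F x \<in> range (\<lambda>v. transpose (DF F x) *v v)"
  shows "\<forall>\<omega> \<in> space M. \<forall>k.
           gn_iterates F \<gamma> x0 (\<lambda>i. S i \<omega>) k = snr_iterates F \<gamma> x0 (\<lambda>i. S i \<omega>) k"
proof (intro ballI allI)
  fix \<omega> k
  show "gn_iterates F \<gamma> x0 (\<lambda>i. S i \<omega>) k = snr_iterates F \<gamma> x0 (\<lambda>i. S i \<omega>) k"
    \<comment> \<open>The range condition holds at every point, so equal iterates receive equal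
      steps along each realization of the sketches.\<close>
    by (induction k) (simp_all add: gn_step_eq[where F = F, OF assms(7)] snr_update_def)
qed

end
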